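(* Let $\Vert\cdot\Vert:\mathbb{R}^{m\times n}\to\mathbb{R}$ be a unitarily invariant matrix norm. Then its dual continuation $\Vert\cdot\Vert:\mathbb{DR}^{m\times n}\to\mathbb{DR}$ is unitarily invariant in dual algebra, i.e. $\Vert\boldsymbol{P}\boldsymbol{X}\boldsymbol{Q}\Vert=\Vert\boldsymbol{X}\Vert$ for every $\boldsymbol{X}\in\mathbb{DR}^{m\times n}$ and all orthogonal $\boldsymbol{P}\in\mathbb{DR}^{m\times m}$ and $\boldsymbol{Q}\in\mathbb{DR}^{n\times n}$.
   Context: Dual numbers: $\mathbb{DR}=\{p_{\rm s}+p_{\rm i}\epsilon: p_{\rm s},p_{\rm i}\in\mathbb{R}\}$ with $\epsilon\neq0$, $\epsilon^2=0$ (a commutative ring). Dual matrices are written $\boldsymbol{A}=\boldsymbol{A}_{\rm s}+\boldsymbol{A}_{\rm i}\epsilon$ with $\boldsymbol{A}_{\rm s},\boldsymbol{A}_{\rm i}$ real. A square dual matrix $\boldsymbol{P}$ is orthogonal if $\boldsymbol{P}\boldsymbol{P}^\top=\boldsymbol{P}^\top\boldsymbol{P}=\boldsymbol{I}$. A norm on $\mathbb{R}^{m\times n}$ is unitarily invariant if $\Vert\boldsymbol{P}\boldsymbol{X}\boldsymbol{Q}\Vert=\Vert\boldsymbol{X}\Vert$ for all real $\boldsymbol{X}$ and all real orthogonal $\boldsymbol{P},\boldsymbol{Q}$. Gâteaux derivative: $\mathcal{D}_u\phi(x)=\lim_{t\downarrow0}\frac{\phi(x+tu)-\phi(x)}{t}$.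 The dual continuation of a real-valued function $\phi$ on a real space $\mathcal{X}$ is $\tilde\phi(a+b\epsilon)=\phi(a)+\mathcal{D}_b\phi(a)\,\epsilon$ for $a,b\in\mathcal{X}$; the dual continuation of a norm is denoted by the same symbol. *)

theory Defs
  imports "HOL-Analysis.Analysis"
begin

datatype dual = Dual (std_part: real) (inf_part: real)

instantiation dual :: comm_ring_1
begin

definition "0 = Dual 0 0"
definition "1 = Dual 1 0"
definition "p + q = Dual (std_part p + std_part q) (inf_part p + inf_part q)"
definition "p - q = Dual (std_part p - std_part q) (inf_part p - inf_part q)"
definition "- p = Dual (- std_part p) (- inf_part p)"
definition "p * q =
  Dual (std_part p * std_part q) (std_part p * inf_part q + inf_part p * std_part q)"

instance
  by standard
    (simp_all add: zero_dual_def one_dual_def plus_dual_def minus_dual_def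
      uminus_dual_def times_dual_def algebra_simps)

end

definition dual_of_real :: "real \<Rightarrow> dual" where
  "dual_of_real r = Dual r 0"

definition dual_eps :: dual where
  "dual_eps = Dual 0 1"

lemma dual_eps_neq_0: "dual_eps \<noteq> 0"
  by (simp add: dual_eps_def zero_dual_def)

lemma dual_eps_power2: "dual_eps ^ 2 = 0"
  by (simp add: dual_eps_def zero_dual_def times_dual_def power2_eq_square)

lemma Dual_eq: "Dual a b = dual_of_real a + dual_of_real b * dual_eps"
  by (simp add: dual_of_real_def dual_eps_def plus_dual_def times_dual_def)

definition std_mat :: "dual ^ 'n ^ 'm \<Rightarrow> real ^ 'n ^ 'm" where
  "std_mat A = (\<chi> i j. std_part (A $ i $ j))"

definition inf_mat :: "dual ^ 'n ^ 'm \<Rightarrow> real ^ 'n ^ 'm" where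
  "inf_mat A = (\<chi> i j. inf_part (A $ i $ j))"

definition is_norm :: "('a::real_vector \<Rightarrow> real) \<Rightarrow> bool" where
  "is_norm N \<longleftrightarrow>
     (\<forall>x. 0 \<le> N x) \<and>
     (\<forall>x. N x = 0 \<longleftrightarrow> x = 0) \<and>
     (\<forall>c x. N (c *\<^sub>R x) = \<bar>c\<bar> * N x) \<and>
     (\<forall>x y. N (x + y) \<le> N x + N y)"

text \<open>Polymorphic in the entries, so that it covers both real-valued functions of real
  matrices and dual-valued functions of dual matrices; orthogonality always refers to the
  entry type of the argument matrix.\<close>

definition unitarily_invariant :: "('r::semiring_1 ^ 'n ^ 'm \<Rightarrow> 'r) \<Rightarrow> bool" where
  "unitarily_invariant f \<longleftrightarrow>
     (\<forall>X P Q. orthogonal_matrix P \<longrightarrow> orthogonal_matrix Q \<longrightarrow> f (P ** X ** Q) = f X)"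

text \<open>One-sided directional derivative of \<open>\<phi>\<close> at \<open>x\<close> in direction \<open>u\<close>. The value is
  meaningful only where the limit exists; for norms it exists everywhere, by
  \<open>is_norm_gateaux_tendsto\<close> below.\<close>

definition gateaux :: "'a::real_vector \<Rightarrow> ('a \<Rightarrow> real) \<Rightarrow> 'a \<Rightarrow> real" where
  "gateaux u \<phi> x = Lim (at_right 0) (\<lambda>t. (\<phi> (x + t *\<^sub>R u) - \<phi> x) / t)"

text \<open>The value of the dual continuation of \<open>\<phi>\<close> at the dual element \<open>a + b \<epsilon>\<close>.\<close>

definition dual_continuation :: "('a::real_vector \<Rightarrow> real) \<Rightarrow> 'a \<Rightarrow> 'a \<Rightarrow> dual" where
  "dual_continuation \<phi> a b = dual_of_real (\<phi> a) + dual_of_real (gateaux b \<phi> a) * dual_eps"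

definition dual_mat_continuation :: "(real ^ 'n ^ 'm \<Rightarrow> real) \<Rightarrow> dual ^ 'n ^ 'm \<Rightarrow> dual" where
  "dual_mat_continuation \<phi> X = dual_continuation \<phi> (std_mat X) (inf_mat X)"

lemma is_norm_gateaux_tendsto:
  assumes "is_norm N"
  shows "((\<lambda>t. (N (x + t *\<^sub>R u) - N x) / t) \<longlongrightarrow> gateaux u N x) (at_right 0)"
proof -
  define q where "q t = (N (x + t *\<^sub>R u) - N x) / t" for t
  have hom: "N (c *\<^sub>R y) = \<bar>c\<bar> * N y" and tri: "N (y + z) \<le> N y + N z" for c y z
    using assms by (auto simp: is_norm_def)
  have mono: "q s \<le> q t" if "0 < s" "s \<le> t" for s t
  proof -
    define c where "c = s / t"
    have c: "0 \<le> c" "c \<le> 1" "c * t = s" "0 < t" using that by (auto simp: c_def)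
    have "x + s *\<^sub>R u = (1 - c) *\<^sub>R x + c *\<^sub>R (x + t *\<^sub>R u)"
      using c by (simp add: algebra_simps)
    then have "N (x + s *\<^sub>R u) \<le> (1 - c) * N x + c * N (x + t *\<^sub>R u)"
      using tri[of "(1 - c) *\<^sub>R x" "c *\<^sub>R (x + t *\<^sub>R u)"] c by (simp add: hom)
    then have "N (x + s *\<^sub>R u) - N x \<le> c * (N (x + t *\<^sub>R u) - N x)"
      by (simp add: algebra_simps)
    also have "\<dots> = s * q t" using c by (simp add: q_def c_def)
    finally show ?thesis using that by (simp add: q_def[of s] divide_le_eq mult.commute)
  qed
  have lower: "- N u \<le> q t" if "0 < t" for t
  proof -
    have "N x \<le> N (x + t *\<^sub>R u) + t * N u"
      using tri[of "x + t *\<^sub>R u" "(- t) *\<^sub>R u"] hom[of "- t" u] that by simp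
    then show ?thesis using that by (simp add: q_def le_divide_eq algebra_simps)
  qed
  define l where "l = Inf (q ` {0<..})"
  have bdd: "bdd_below (q ` {0<..})" using lower by (auto intro!: bdd_belowI2)
  have "(q \<longlongrightarrow> l) (at_right 0)"
  proof (rule order_tendstoI)
    fix a assume "a < l"
    moreover have "l \<le> q t" if "0 < t" for t
      unfolding l_def using bdd that by (intro cInf_lower) auto
    ultimately show "\<forall>\<^sub>F t in at_right 0. a < q t"
      by (auto simp: eventually_at_right_field intro!: exI[of _ 1] less_le_trans[of a l])
  next
    fix a assume "l < a"
    then obtain t where t: "0 < t" "q t < a"
      unfolding l_def using cInf_lessD[of "q ` {0<..}" a] by auto
    then show "\<forall>\<^sub>F t in at_right 0. q t < a"
      using mono by (auto simp: eventually_at_right_field intro!: exI[of _ t] le_less_trans[of _ "q t" a])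
  qed
  moreover from this have "gateaux u N x = l"
    unfolding gateaux_def q_def by (intro tendsto_Lim) auto
  ultimately show ?thesis by (simp add: q_def[abs_def])
qed

end

theory Submission
  imports Defs
begin

text \<open>
  Write the dual orthogonal matrices as \<open>P = A + B \<epsilon>\<close> and \<open>Q = C + D \<epsilon>\<close>. Comparing standard and
  infinitesimal parts in \<open>P\<^sup>T P = 1\<close> and \<open>Q Q\<^sup>T = 1\<close> shows that \<open>A\<close> and \<open>C\<close> are real orthogonal
  and that \<open>S = A\<^sup>T B\<close> and \<open>T = D C\<^sup>T\<close> are skew-symmetric: a dual orthogonal matrix is a point of
  the orthogonal group together with a tangent vector there. For \<open>X = Y + Z \<epsilon>\<close> this gives
  \<open>P X Q = A (Y + (Z + S Y + Y T) \<epsilon>) C\<close>. The outer factors \<open>A\<close> and \<open>C\<close> do not change the norm of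
  any point \<open>Y + t W\<close>, so it remains to see that adding the directions \<open>S Y\<close> and \<open>Y T\<close>, which are
  tangent to the orbit of \<open>Y\<close>, leaves the directional derivative of the norm \<open>N\<close> unchanged.

  This is done without matrix exponentials. If \<open>K\<close> is skew-symmetric, then the Cayley transform
  of \<open>K\<close> is an orthogonal matrix \<open>R\<close> with \<open>1 + K = R (1 - K)\<close>
  (\<open>skew_symmetric_Cayley_transform\<close>), whence \<open>N (M + K M) = N (M - K M)\<close> for every \<open>M\<close>.
  With \<open>K = (t/2) S\<close> and \<open>M = Y + t Z + K Y\<close> the two arguments are \<open>Y + t (Z + S Y)\<close> and
  \<open>Y + t Z\<close>, each up to an error \<open>t\<^sup>2 E\<close> with \<open>E\<close> independent of \<open>t\<close>; so the two difference
  quotients differ by \<open>O(t)\<close> (\<open>gateaux_add_infinitesimal_isometry\<close>). Multiplication by \<open>T\<close> from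
  the right is treated in the same way.
\<close>

section \<open>Matrix algebra\<close>

lemma matrix_add_right_distrib:
  fixes A B :: "'a::semiring_1 ^ 'n ^ 'm" and C :: "'a ^ 'p ^ 'n"
  shows "(A + B) ** C = A ** C + B ** C"
  by (simp add: matrix_matrix_mult_def vec_eq_iff distrib_right sum.distrib)

lemma matrix_diff_right_distrib:
  fixes A B :: "'a::ring_1 ^ 'n ^ 'm" and C :: "'a ^ 'p ^ 'n"
  shows "(A - B) ** C = A ** C - B ** C"
  by (simp add: matrix_matrix_mult_def vec_eq_iff left_diff_distrib sum_subtractf)

lemma matrix_diff_left_distrib:
  fixes A :: "'a::ring_1 ^ 'n ^ 'm" and B C :: "'a ^ 'p ^ 'n"
  shows "A ** (B - C) = A ** B - A ** C"
  by (simp add: matrix_matrix_mult_def vec_eq_iff right_diff_distrib sum_subtractf)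

lemma transpose_add: "transpose (A + B) = transpose A + transpose B"
  by (simp add: transpose_def vec_eq_iff)

lemma transpose_diff: "transpose (A - B) = transpose A - transpose B"
  by (simp add: transpose_def vec_eq_iff)

lemma transpose_minus: "transpose (- A) = - transpose A"
  by (simp add: transpose_def vec_eq_iff)

lemmas matrix_ring_simps =
  matrix_add_ldistrib matrix_add_right_distrib matrix_diff_left_distrib matrix_diff_right_distrib

section \<open>Skew-symmetric matrices and the Cayley transform\<close>

lemma skew_symmetric_inner_self:
  fixes K :: "real ^ 'n ^ 'n"
  assumes "transpose K = - K"
  shows "x \<bullet> (K *v x) = 0"
proof -
  have "x \<bullet> (K *v x) = (transpose K *v x) \<bullet> x"
    by (simp add: dot_lmul_matrix)
  also have "\<dots> = - ((K *v x) \<bullet> x)"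
    unfolding assms by (simp add: matrix_vector_mult_def inner_vec_def sum_negf)
  finally show ?thesis
    by (simp add: inner_commute)
qed

text \<open>
  The matrix \<open>R\<close> is \<open>(1 + K) (1 - K)\<^sup>-\<^sup>1\<close>. The inverse exists because \<open>K x = x\<close> forces
  \<open>x \<bullet> x = x \<bullet> K x = 0\<close>, and orthogonality amounts to \<open>1 + K\<close> and \<open>1 - K\<close> being commuting
  transposes of each other.
\<close>

lemma skew_symmetric_Cayley_transform:
  fixes K :: "real ^ 'n ^ 'n"
  assumes skew: "transpose K = - K"
  obtains R where "orthogonal_matrix R" and "mat 1 + K = R ** (mat 1 - K)"
proof -
  have "x = 0" if "(mat 1 - K) *v x = 0" for x
  proof -
    have "x = K *v x"
      using that by (simp add: matrix_vector_mult_diff_rdistrib)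
    then have "x \<bullet> x = 0"
      using skew_symmetric_inner_self[OF skew, of x] by simp
    then show ?thesis by simp
  qed
  then obtain J where J: "J ** (mat 1 - K) = mat 1"
    using matrix_left_invertible_ker[of "mat 1 - K"] by blast
  then have J': "(mat 1 - K) ** J = mat 1"
    by (simp add: matrix_left_right_inverse)
  have tr_plus: "transpose (mat 1 + K) = mat 1 - K"
    and tr_minus: "transpose (mat 1 - K) = mat 1 + K"
    by (simp_all add: transpose_add transpose_diff skew)
  have comm: "(mat 1 - K) ** (mat 1 + K) = (mat 1 + K) ** (mat 1 - K)"
    by (simp add: matrix_ring_simps)
  define R where "R = (mat 1 + K) ** J"
  have "transpose R ** R = transpose J ** ((mat 1 - K) ** (mat 1 + K)) ** J"
    by (simp add: R_def matrix_transpose_mul tr_plus matrix_mul_assoc)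
  also have "\<dots> = transpose ((mat 1 - K) ** J) ** ((mat 1 - K) ** J)"
    by (simp add: comm matrix_transpose_mul tr_minus matrix_mul_assoc)
  also have "\<dots> = mat 1"
    by (simp add: J')
  finally have "orthogonal_matrix R"
    by (simp add: orthogonal_matrix)
  moreover have "mat 1 + K = R ** (mat 1 - K)"
    by (simp add: R_def J flip: matrix_mul_assoc)
  ultimately show thesis by (rule that)
qed

section \<open>Directional derivatives along orbits\<close>

text \<open>
  Think of \<open>L\<close> as the generator of a one-parameter group of \<open>N\<close>-isometries, so that \<open>L y\<close> is the
  velocity at \<open>y\<close> of a curve along which \<open>N\<close> is constant. The hypothesis \<open>isometry\<close> expresses
  this by the Cayley transforms of the multiples of \<open>L\<close>, in a form that mentions no inverse.
\<close>

lemma gateaux_add_infinitesimal_isometry: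
  fixes N :: "'a::real_vector \<Rightarrow> real"
  assumes N: "is_norm N" and "linear L"
    and isometry: "\<And>k w. N (w + k *\<^sub>R L w) = N (w - k *\<^sub>R L w)"
  shows "gateaux (z + L y) N y = gateaux z N y"
proof -
  interpret linear L by fact
  have hom: "N (c *\<^sub>R v) = \<bar>c\<bar> * N v" and tri: "N (v + w) \<le> N v + N w" for c v w
    using N by (auto simp: is_norm_def)
  have perturb: "N a - N b \<le> 2 * N e" if "N (a + e) = N (b - e)" for a b e
  proof -
    have "N a \<le> N (a + e) + N e" and "N (b - e) \<le> N b + N e"
      using tri[of "a + e" "- e"] tri[of b "- e"] hom[of "-1" e] by simp_all
    then show ?thesis using that by simp
  qed
  define E where "E = (1/2) *\<^sub>R L z + (1/4) *\<^sub>R L (L y)"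
  define q where "q u t = (N (y + t *\<^sub>R u) - N y) / t" for u t
  have bound: "\<bar>q (z + L y) t - q z t\<bar> \<le> 2 * t * N E" if "0 < t" for t
  proof -
    define a b where "a = y + t *\<^sub>R (z + L y)" and "b = y + t *\<^sub>R z"
    \<comment> \<open>The shift \<open>(t/2) L y\<close> makes \<open>w \<plusminus> (t/2) L w\<close> agree with \<open>a\<close> and \<open>b\<close> up to second order
      in \<open>t\<close>; the remainder is \<open>t\<^sup>2 E\<close> in both cases, with opposite signs.\<close>
    define w where "w = y + t *\<^sub>R z + (t/2) *\<^sub>R L y"
    have "L w = L y + t *\<^sub>R L z + (t/2) *\<^sub>R L (L y)"
      by (simp add: w_def add scale)
    then have Lw: "(t/2) *\<^sub>R L w = (t/2) *\<^sub>R L y + (t * t) *\<^sub>R E"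
      by (simp add: E_def scaleR_add_right)
    have "t *\<^sub>R L y = (t/2) *\<^sub>R L y + (t/2) *\<^sub>R L y"
      by (simp flip: scaleR_add_left)
    then have "w + (t/2) *\<^sub>R L w = a + (t * t) *\<^sub>R E" "w - (t/2) *\<^sub>R L w = b - (t * t) *\<^sub>R E"
      unfolding Lw by (simp_all add: w_def a_def b_def scaleR_add_right)
    then have eq: "N (a + (t * t) *\<^sub>R E) = N (b - (t * t) *\<^sub>R E)"
      using isometry[of w "t/2"] by simp
    have "N a - N b \<le> 2 * N ((t * t) *\<^sub>R E)"
      using eq by (rule perturb)
    moreover have "N b - N a \<le> 2 * N (- ((t * t) *\<^sub>R E))"
      using eq by (intro perturb) simp
    moreover have "N (- ((t * t) *\<^sub>R E)) = t * t * N E" "N ((t * t) *\<^sub>R E) = t * t * N E"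
      using hom[of "t * t" E] hom[of "- (t * t)" E] by simp_all
    ultimately have "\<bar>N a - N b\<bar> \<le> 2 * t * N E * t"
      by (simp add: mult_ac)
    moreover have "q (z + L y) t - q z t = (N a - N b) / t"
      by (simp add: q_def a_def b_def diff_divide_distrib)
    ultimately show ?thesis
      using that by (simp add: pos_divide_le_eq)
  qed
  have "((\<lambda>t. 2 * t * N E) \<longlongrightarrow> 2 * 0 * N E) (at_right 0)"
    by (intro tendsto_intros)
  then have "((\<lambda>t. 2 * t * N E) \<longlongrightarrow> 0) (at_right 0)"
    by simp
  moreover have "\<forall>\<^sub>F t in at_right 0. norm (q (z + L y) t - q z t) \<le> 2 * t * N E"
    using eventually_at_right_less[of 0] by (rule eventually_mono) (simp only: real_norm_def bound)
  ultimately have lim_0: "((\<lambda>t. q (z + L y) t - q z t) \<longlongrightarrow> 0) (at_right 0)"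
    by (rule Lim_null_comparison[rotated])
  have "((\<lambda>t. q (z + L y) t - q z t) \<longlongrightarrow> gateaux (z + L y) N y - gateaux z N y) (at_right 0)"
    unfolding q_def by (intro tendsto_diff is_norm_gateaux_tendsto N)
  then have "gateaux (z + L y) N y - gateaux z N y = 0"
    using lim_0 by (rule tendsto_unique[OF trivial_limit_at_right_real])
  then show ?thesis by simp
qed

lemma gateaux_add_skew_mult_left:
  fixes N :: "real ^ 'n ^ 'm \<Rightarrow> real"
  assumes N: "is_norm N" "unitarily_invariant N" and skew: "transpose S = - S"
  shows "gateaux (Z + S ** Y) N Y = gateaux Z N Y"
proof (rule gateaux_add_infinitesimal_isometry[where L = "\<lambda>X. S ** X"])
  show "linear (\<lambda>X. S ** X)"
    by (intro linearI) (simp_all add: matrix_add_ldistrib matrix_scalar_ac scalar_matrix_assoc)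
next
  fix k :: real and M :: "real ^ 'n ^ 'm"
  have "transpose (k *\<^sub>R S) = - (k *\<^sub>R S)"
    by (simp add: transpose_scalar skew)
  then obtain R where R: "orthogonal_matrix R" "mat 1 + k *\<^sub>R S = R ** (mat 1 - k *\<^sub>R S)"
    by (rule skew_symmetric_Cayley_transform)
  have "N ((mat 1 + k *\<^sub>R S) ** M) = N (R ** ((mat 1 - k *\<^sub>R S) ** M) ** mat 1)"
    by (simp add: R(2) matrix_mul_assoc)
  also have "\<dots> = N ((mat 1 - k *\<^sub>R S) ** M)"
    using N(2) R(1) orthogonal_matrix_id unfolding unitarily_invariant_def by blast
  finally show "N (M + k *\<^sub>R (S ** M)) = N (M - k *\<^sub>R (S ** M))"
    by (simp add: matrix_ring_simps scalar_matrix_assoc)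
qed (fact N)

lemma gateaux_add_skew_mult_right:
  fixes N :: "real ^ 'n ^ 'm \<Rightarrow> real"
  assumes N: "is_norm N" "unitarily_invariant N" and skew: "transpose T = - T"
  shows "gateaux (Z + Y ** T) N Y = gateaux Z N Y"
proof (rule gateaux_add_infinitesimal_isometry[where L = "\<lambda>X. X ** T"])
  show "linear (\<lambda>X. X ** T)"
    by (intro linearI) (simp_all add: matrix_add_right_distrib scalar_matrix_assoc)
next
  fix k :: real and M :: "real ^ 'n ^ 'm"
  \<comment> \<open>Here the orthogonal factor is needed on the right; transposing the Cayley identity of the
    transposed matrix puts it there.\<close>
  have "transpose (transpose (k *\<^sub>R T)) = - transpose (k *\<^sub>R T)"
    by (simp add: transpose_scalar transpose_minus skew)
  then obtain R where R: "orthogonal_matrix R"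
      "mat 1 + transpose (k *\<^sub>R T) = R ** (mat 1 - transpose (k *\<^sub>R T))"
    by (rule skew_symmetric_Cayley_transform)
  from arg_cong[OF R(2), of transpose]
  have R': "mat 1 + k *\<^sub>R T = (mat 1 - k *\<^sub>R T) ** transpose R"
    by (simp add: matrix_transpose_mul transpose_add transpose_diff)
  have "N (M ** (mat 1 + k *\<^sub>R T)) = N (mat 1 ** (M ** (mat 1 - k *\<^sub>R T)) ** transpose R)"
    by (simp add: R' matrix_mul_assoc)
  also have "\<dots> = N (M ** (mat 1 - k *\<^sub>R T))"
    using N(2) R(1) orthogonal_matrix_id orthogonal_matrix_transpose
    unfolding unitarily_invariant_def by blast
  finally show "N (M + k *\<^sub>R (M ** T)) = N (M - k *\<^sub>R (M ** T))"
    by (simp add: matrix_ring_simps matrix_scalar_ac scalar_matrix_assoc)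
qed (fact N)

lemma gateaux_orthogonal_mult:
  fixes N :: "real ^ 'n ^ 'm \<Rightarrow> real"
  assumes "unitarily_invariant N" and "orthogonal_matrix A" and "orthogonal_matrix C"
  shows "gateaux (A ** W ** C) N (A ** Y ** C) = gateaux W N Y"
proof -
  have inv: "N (A ** X ** C) = N X" for X
    using assms by (simp add: unitarily_invariant_def)
  have "A ** Y ** C + t *\<^sub>R (A ** W ** C) = A ** (Y + t *\<^sub>R W) ** C" for t
    by (simp add: matrix_add_ldistrib matrix_add_right_distrib matrix_scalar_ac scalar_matrix_assoc)
  then show ?thesis
    by (simp add: gateaux_def inv)
qed

section \<open>Dual orthogonal matrices\<close>

lemma std_part_sum: "std_part (sum f A) = (\<Sum>x\<in>A. std_part (f x))"
  by (induction A rule: infinite_finite_induct) (simp_all add: zero_dual_def plus_dual_def)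

lemma inf_part_sum: "inf_part (sum f A) = (\<Sum>x\<in>A. inf_part (f x))"
  by (induction A rule: infinite_finite_induct) (simp_all add: zero_dual_def plus_dual_def)

lemma std_mat_mult: "std_mat (A ** B) = std_mat A ** std_mat B"
  by (simp add: std_mat_def matrix_matrix_mult_def std_part_sum times_dual_def)

lemma inf_mat_mult: "inf_mat (A ** B) = std_mat A ** inf_mat B + inf_mat A ** std_mat B"
  by (simp add: std_mat_def inf_mat_def matrix_matrix_mult_def inf_part_sum times_dual_def
      vec_eq_iff sum.distrib)

lemma std_mat_transpose: "std_mat (transpose A) = transpose (std_mat A)"
  by (simp add: std_mat_def transpose_def)

lemma inf_mat_transpose: "inf_mat (transpose A) = transpose (inf_mat A)"
  by (simp add: inf_mat_def transpose_def)

lemma std_mat_id: "std_mat (mat 1) = mat 1"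
  by (simp add: std_mat_def mat_def vec_eq_iff zero_dual_def one_dual_def)

lemma inf_mat_id: "inf_mat (mat 1) = 0"
  by (simp add: inf_mat_def mat_def vec_eq_iff zero_dual_def one_dual_def)

lemma orthogonal_std_mat:
  assumes "orthogonal_matrix P"
  shows "orthogonal_matrix (std_mat P)"
  using assms unfolding orthogonal_matrix_def
  by (metis std_mat_id std_mat_mult std_mat_transpose)

text \<open>
  With \<open>P = A + B \<epsilon>\<close>, the infinitesimal part of \<open>P\<^sup>T P = 1\<close> is \<open>A\<^sup>T B + B\<^sup>T A = 0\<close>, so
  \<open>S = A\<^sup>T B\<close> is skew-symmetric, and \<open>A S = B\<close> because \<open>A A\<^sup>T = 1\<close>.
\<close>

lemma orthogonal_inf_mat_left:
  assumes "orthogonal_matrix P"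
  obtains S where "transpose S = - S" and "inf_mat P = std_mat P ** S"
proof
  define S where "S = transpose (std_mat P) ** inf_mat P"
  have "inf_mat (transpose P ** P) = 0"
    using assms by (simp add: orthogonal_matrix_def inf_mat_id)
  then have "S + transpose S = 0"
    by (simp add: S_def inf_mat_mult std_mat_transpose inf_mat_transpose matrix_transpose_mul)
  then show "transpose S = - S"
    by (simp add: add_eq_0_iff)
  show "inf_mat P = std_mat P ** S"
    using orthogonal_std_mat[OF assms] by (simp add: S_def matrix_mul_assoc orthogonal_matrix_def)
qed

lemma orthogonal_inf_mat_right:
  assumes "orthogonal_matrix Q"
  obtains T where "transpose T = - T" and "inf_mat Q = T ** std_mat Q"
proof -
  obtain S where S: "transpose S = - S" "inf_mat (transpose Q) = std_mat (transpose Q) ** S"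
    using orthogonal_inf_mat_left[of "transpose Q"] assms by auto
  from arg_cong[OF S(2), of transpose] have "inf_mat Q = transpose S ** std_mat Q"
    by (simp add: inf_mat_transpose std_mat_transpose matrix_transpose_mul)
  moreover have "transpose (transpose S) = - transpose S"
    by (simp add: S(1) transpose_minus)
  ultimately show thesis by (rule that[rotated])
qed

theorem theorem5p6:
  fixes N :: "real ^ 'n ^ 'm \<Rightarrow> real"
  assumes "is_norm N"
    and "unitarily_invariant N"
  shows "unitarily_invariant (dual_mat_continuation N)"
  unfolding unitarily_invariant_def
proof (intro allI impI)
  fix X :: "dual ^ 'n ^ 'm" and P :: "dual ^ 'm ^ 'm" and Q :: "dual ^ 'n ^ 'n"
  assume P: "orthogonal_matrix P" and Q: "orthogonal_matrix Q"
  obtain S where S: "transpose S = - S" "inf_mat P = std_mat P ** S"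
    using P by (rule orthogonal_inf_mat_left)
  obtain T where T: "transpose T = - T" "inf_mat Q = T ** std_mat Q"
    using Q by (rule orthogonal_inf_mat_right)
  let ?A = "std_mat P" and ?C = "std_mat Q" and ?Y = "std_mat X" and ?Z = "inf_mat X"
  have orth: "orthogonal_matrix ?A" "orthogonal_matrix ?C"
    using P Q by (simp_all add: orthogonal_std_mat)
  have std: "std_mat (P ** X ** Q) = ?A ** ?Y ** ?C"
    by (simp add: std_mat_mult)
  have inf: "inf_mat (P ** X ** Q) = ?A ** (?Z + S ** ?Y + ?Y ** T) ** ?C"
    by (simp add: inf_mat_mult std_mat_mult S(2) T(2) matrix_ring_simps matrix_mul_assoc add_ac)
  have "gateaux (inf_mat (P ** X ** Q)) N (std_mat (P ** X ** Q))
      = gateaux (?Z + S ** ?Y + ?Y ** T) N ?Y"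
    unfolding std inf using assms(2) orth by (rule gateaux_orthogonal_mult)
  also have "\<dots> = gateaux ?Z N ?Y"
    by (simp add: gateaux_add_skew_mult_right gateaux_add_skew_mult_left assms S(1) T(1))
  finally have "gateaux (inf_mat (P ** X ** Q)) N (std_mat (P ** X ** Q)) = gateaux ?Z N ?Y" .
  moreover have "N (std_mat (P ** X ** Q)) = N ?Y"
    using assms(2) orth by (simp add: std unitarily_invariant_def)
  ultimately show "dual_mat_continuation N (P ** X ** Q) = dual_mat_continuation N X"
    by (simp add: dual_mat_continuation_def dual_continuation_def)
qed

end
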